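(* In the Laurent polynomial ring $\mathbb{Z}[a^{\pm1},b_0^{\pm1},b_1,b_2,b_3^{\pm1},b_\infty^{\pm1}]$, the Hopf relation $R_{\mathrm{Hopf}}$ is not a factor of the trefoil relation $R_{\mathrm{tr}_+}$, and $R_{\mathrm{tr}_+}$ is not a factor of $R_{\mathrm{Hopf}}$.
   Context: Put $$t=-\frac{b_0+b_1a^{-1}+b_2a^{-2}+b_3a^{-3}}{b_\infty},$$ $$H_+=-b_3^{-1}t\,(b_2a+b_0a^{-1}+b_\infty a+b_1t),\qquad H_-=-b_0^{-1}t\,(b_1a^{-1}+b_2t+b_3a+b_\infty a^2).$$ The Hopf relation is $R_{\mathrm{Hopf}}=H_+-H_-$. The trefoil relation is $R_{\mathrm{tr}_+}=\overline{3_1}-(\overline{3_1})_2$, where $$\overline{3_1}=-b_3^{-1}\big(b_2H_++a\,b_1t+b_0t^2+b_\infty t\big),$$ $$(\overline{3_1})_2=(ab_0)^{-2}\Big((b_2b_3-b_0b_1)t+a^3(ab_3b_\infty-b_0b_2)t+a(b_1b_3-a^2b_0b_\infty)H_++a\,b_3^2t^2\Big).$$ All of these are regarded as elements of $\mathbb{Z}[a^{\pm1},b_0^{\pm1},b_1,b_2,b_3^{\pm1},b_\infty^{\pm1}]$ after substituting the expression for $t$. *)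

theory Defs
  imports "HOL-Library.Poly_Mapping" "HOL-Library.Product_Plus"
begin

text \<open>
  The Laurent polynomial ring
  \<open>\<int>[a\<^sup>\<plusminus>\<^sup>1, b0\<^sup>\<plusminus>\<^sup>1, b1, b2, b3\<^sup>\<plusminus>\<^sup>1, binf\<^sup>\<plusminus>\<^sup>1]\<close> is the monoid algebra over \<open>\<int>\<close> of
  the exponent monoid below: finitely supported integer-valued functions under convolution. The
  components are the exponents of \<open>a, b0, b1, b2, b3, binf\<close>, in this order; those of \<open>b1\<close> and \<open>b2\<close>
  are natural numbers, so that these two variables are not inverted.
\<close>

type_synonym expo = "int \<times> int \<times> nat \<times> nat \<times> int \<times> int"

type_synonym laurent = "expo \<Rightarrow>\<^sub>0 int"

definition a :: laurent where "a = Poly_Mapping.single (1, 0, 0, 0, 0, 0) 1"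
definition b0 :: laurent where "b0 = Poly_Mapping.single (0, 1, 0, 0, 0, 0) 1"
definition b1 :: laurent where "b1 = Poly_Mapping.single (0, 0, 1, 0, 0, 0) 1"
definition b2 :: laurent where "b2 = Poly_Mapping.single (0, 0, 0, 1, 0, 0) 1"
definition b3 :: laurent where "b3 = Poly_Mapping.single (0, 0, 0, 0, 1, 0) 1"
definition binf :: laurent where "binf = Poly_Mapping.single (0, 0, 0, 0, 0, 1) 1"

definition a_inv :: laurent where "a_inv = Poly_Mapping.single (-1, 0, 0, 0, 0, 0) 1"
definition b0_inv :: laurent where "b0_inv = Poly_Mapping.single (0, -1, 0, 0, 0, 0) 1"
definition b3_inv :: laurent where "b3_inv = Poly_Mapping.single (0, 0, 0, 0, -1, 0) 1"
definition binf_inv :: laurent where "binf_inv = Poly_Mapping.single (0, 0, 0, 0, 0, -1) 1"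

lemma laurent_inverses:
  "a * a_inv = 1" "b0 * b0_inv = 1" "b3 * b3_inv = 1" "binf * binf_inv = 1"
  by (simp_all add: a_def a_inv_def b0_def b0_inv_def b3_def b3_inv_def binf_def binf_inv_def
      mult_single flip: zero_prod_def single_one)

definition t :: laurent where
  "t = - ((b0 + b1 * a_inv + b2 * a_inv ^ 2 + b3 * a_inv ^ 3) * binf_inv)"

definition H_plus :: laurent where
  "H_plus = - b3_inv * t * (b2 * a + b0 * a_inv + binf * a + b1 * t)"

definition H_minus :: laurent where
  "H_minus = - b0_inv * t * (b1 * a_inv + b2 * t + b3 * a + binf * a ^ 2)"

definition R_Hopf :: laurent where
  "R_Hopf = H_plus - H_minus"

text \<open>The two expressions \<open>trefoil\<close> and \<open>trefoil2\<close> are the elements written \<open>3\<^sub>1\<close> with an overline,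
  without and with the outer subscript 2.\<close>

definition trefoil :: laurent where
  "trefoil = - b3_inv * (b2 * H_plus + a * b1 * t + b0 * t ^ 2 + binf * t)"

definition trefoil2 :: laurent where
  "trefoil2 = (a_inv * b0_inv) ^ 2 *
     ((b2 * b3 - b0 * b1) * t
      + a ^ 3 * (a * b3 * binf - b0 * b2) * t
      + a * (b1 * b3 - a ^ 2 * b0 * binf) * H_plus
      + a * b3 ^ 2 * t ^ 2)"

definition R_trefoil :: laurent where
  "R_trefoil = trefoil - trefoil2"

end

theory Submission
  imports Defs
begin

text \<open>
  Specializing \<open>a = b0 = b3 = binf = 1\<close>, \<open>b1 = x\<close>, \<open>b2 = y\<close> gives a ring homomorphism to \<open>\<int>\<close>, and
  divisibility is preserved by it. At \<open>(x, y) = (1, 1)\<close> the Hopf relation vanishes whereas the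
  trefoil relation takes the value \<open>-20\<close>; at \<open>(x, y) = (2, 0)\<close> the trefoil relation vanishes whereas
  the Hopf relation takes the value \<open>-40\<close>.
\<close>

text \<open>The linear extension of \<open>w\<close> to the monoid algebra; for multiplicative
  \<open>w\<close> it is evaluation.\<close>

definition weighted_sum :: "('k \<Rightarrow> 'r) \<Rightarrow> ('k \<Rightarrow>\<^sub>0 'r) \<Rightarrow> 'r::comm_ring_1"
  where "weighted_sum w p = (\<Sum>k\<in>Poly_Mapping.keys p. Poly_Mapping.lookup p k * w k)"

text \<open>Coefficients vanish off the keys. This gives sums with different supports a common index
  set, even when terms cancel in \<open>p + q\<close>.\<close>

lemma weighted_sum_superset:
  assumes "finite S" "Poly_Mapping.keys p \<subseteq> S"
  shows "weighted_sum w p = (\<Sum>k\<in>S. Poly_Mapping.lookup p k * w k)"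
  unfolding weighted_sum_def
  by (rule sum.mono_neutral_left) (use assms in \<open>auto simp: in_keys_iff\<close>)

lemma weighted_sum_add: "weighted_sum w (p + q) = weighted_sum w p + weighted_sum w q"
proof -
  let ?S = "Poly_Mapping.keys p \<union> Poly_Mapping.keys q"
  have "weighted_sum w (p + q) = (\<Sum>k\<in>?S. Poly_Mapping.lookup (p + q) k * w k)"
    by (rule weighted_sum_superset) (use keys_add[of p q] in auto)
  also have "\<dots> = (\<Sum>k\<in>?S. Poly_Mapping.lookup p k * w k) + (\<Sum>k\<in>?S. Poly_Mapping.lookup q k * w k)"
    by (simp add: lookup_add distrib_right sum.distrib)
  also have "\<dots> = weighted_sum w p + weighted_sum w q"
    by (simp add: weighted_sum_superset[of ?S])
  finally show ?thesis .
qed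

lemma weighted_sum_zero: "weighted_sum w 0 = 0"
  by (simp add: weighted_sum_def)

lemma weighted_sum_uminus: "weighted_sum w (- p) = - weighted_sum w p"
  using weighted_sum_add[of w p "- p"]
  by (simp add: weighted_sum_zero minus_unique)

lemma weighted_sum_diff: "weighted_sum w (p - q) = weighted_sum w p - weighted_sum w q"
  using weighted_sum_add[of w p "- q"] by (simp add: weighted_sum_uminus)

lemma weighted_sum_single: "weighted_sum w (Poly_Mapping.single k c) = c * w k"
  by (simp add: weighted_sum_superset[of "{k}"])

lemma poly_mapping_single_add_induct [case_names zero single_add]:
  assumes "P 0"
    and "\<And>k c p. P p \<Longrightarrow> P (Poly_Mapping.single k c + p)"
  shows "P (p :: 'k \<Rightarrow>\<^sub>0 'r::monoid_add)"
proof (induction p rule: update_induct)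
  case const
  then show ?case using assms(1) by simp
next
  case (update f k c)
  \<comment> \<open>The key \<open>k\<close> is fresh for \<open>f\<close>, so overwriting the value
    0 there amounts to adding \<open>c\<close>.\<close>
  have "Poly_Mapping.update k c f = Poly_Mapping.single k c + f"
    using update(1)
    by (intro poly_mapping_eqI)
      (auto simp: lookup_update lookup_add lookup_single when_def in_keys_iff)
  then show ?case using assms(2)[OF update(3)] by simp
qed

text \<open>By additivity in each factor, only products of two monomials matter, and there the claim
  is the assumption on \<open>w\<close>.\<close>

lemma weighted_sum_mult:
  fixes w :: "'k::monoid_add \<Rightarrow> 'r::comm_ring_1"
  assumes w: "\<And>k l. w (k + l) = w k * w l"
  shows "weighted_sum w (p * q) = weighted_sum w p * weighted_sum w q"
proof (induction p rule: poly_mapping_single_add_induct)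
  case zero
  show ?case by (simp add: weighted_sum_zero)
next
  case (single_add k c p)
  have "weighted_sum w (Poly_Mapping.single k c * q) = c * w k * weighted_sum w q"
  proof (induction q rule: poly_mapping_single_add_induct)
    case zero
    show ?case by (simp add: weighted_sum_zero)
  next
    case (single_add l d q)
    then show ?case
      by (simp add: weighted_sum_add weighted_sum_single mult_single w algebra_simps)
  qed
  with single_add show ?case
    by (simp add: weighted_sum_add weighted_sum_single algebra_simps)
qed

text \<open>The inverted variables go to 1, so their exponents drop out; \<open>x\<close> and
  \<open>y\<close> carry only natural exponents and may be any integers, including 0.\<close>

definition specialize :: "int \<Rightarrow> int \<Rightarrow> laurent \<Rightarrow> int"
  where "specialize x y = weighted_sum (\<lambda>(_, _, m, n, _, _). x ^ m * y ^ n)"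

lemma specialize_mult: "specialize x y (p * q) = specialize x y p * specialize x y q"
  unfolding specialize_def
  by (rule weighted_sum_mult) (auto simp: power_add)

lemma specialize_square: "specialize x y (p ^ 2) = specialize x y p ^ 2"
  by (simp add: power2_eq_square specialize_mult)

lemma specialize_cube: "specialize x y (p ^ 3) = specialize x y p ^ 3"
  by (simp add: power3_eq_cube specialize_mult)

lemma specialize_additive:
  "specialize x y (p + q) = specialize x y p + specialize x y q"
  "specialize x y (p - q) = specialize x y p - specialize x y q"
  "specialize x y (- p) = - specialize x y p"
  by (simp_all add: specialize_def weighted_sum_add weighted_sum_diff weighted_sum_uminus)

lemma specialize_variables:
  "specialize x y a = 1" "specialize x y a_inv = 1"
  "specialize x y b0 = 1" "specialize x y b0_inv = 1"
  "specialize x y b1 = x" "specialize x y b2 = y"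
  "specialize x y b3 = 1" "specialize x y b3_inv = 1"
  "specialize x y binf = 1" "specialize x y binf_inv = 1"
  by (simp_all add: specialize_def weighted_sum_single a_def a_inv_def b0_def b0_inv_def b1_def
      b2_def b3_def b3_inv_def binf_def binf_inv_def)

lemmas specialize_simps =
  specialize_mult specialize_square specialize_cube specialize_additive specialize_variables

text \<open>With \<open>t = - (2 + x + y)\<close> the value is
  \<open>- t * (x - y) * (t - 1)\<close>, which vanishes on the diagonal \<open>x = y\<close>. At
  both points \<open>t = - 4\<close>.\<close>

lemma specialize_R_Hopf:
  "specialize 1 1 R_Hopf = 0" "specialize 2 0 R_Hopf = - 40"
  by (simp_all add: R_Hopf_def H_plus_def H_minus_def t_def specialize_simps)

text \<open>\<open>trefoil\<close> and \<open>trefoil2\<close> become -4 and 16 at (1, 1), and both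
  become -4 at (2, 0).\<close>

lemma specialize_R_trefoil:
  "specialize 1 1 R_trefoil = - 20" "specialize 2 0 R_trefoil = 0"
  by (simp_all add: R_trefoil_def trefoil_def trefoil2_def H_plus_def t_def specialize_simps)

lemma specialize_dvd: "p dvd q \<Longrightarrow> specialize x y p dvd specialize x y q"
  by (auto simp: dvd_def specialize_mult)

theorem proposition9p9:
  shows "\<not> R_Hopf dvd R_trefoil \<and> \<not> R_trefoil dvd R_Hopf"
  \<comment> \<open>Each divisibility would make 0 divide a nonzero integer.\<close>
  using specialize_dvd[of R_Hopf R_trefoil 1 1] specialize_dvd[of R_trefoil R_Hopf 2 0]
  by (auto simp: specialize_R_Hopf specialize_R_trefoil)

end
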